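(* Let $N\ge 2$, let $0<u_1<u_2<\cdots<u_N$ be real numbers, let $s\in\mathbb{C}$ with $s\ne-2,-4,\dots,-2(N-1)$, and let $\mathbf{X}=(X_1,\dots,X_{N-1})$ be a random vector with probability density $$(N-1)!\,\frac{\prod_{1\le i<j\le N-1}(x_j-x_i)}{\prod_{1\le i<j\le N}(u_j-u_i)}$$ on the domain $\{u_1<x_1<u_2<x_2<\cdots<x_{N-1}<u_N\}$. Then $$ \frac{2}{s\,\Gamma_{N-1}\left(\frac s2\right)}\,N^{s/2}\,\mathbb{E}\left[\frac{\prod_{n=1}^{N-1}X_n^{s/2}}{\prod_{n=1}^{N}u_n^{s/2}}\right] =\frac{V_N^{(s/2)}(\mathbf{u})}{V_N^{(0)}(\mathbf{u})} =\sum_{n=1}^N(-1)^{n-1}\frac{1}{u_n^{s/2}}\prod_{\substack{1\le j\le N\\ j\ne n}}\frac{u_j}{|u_j-u_n|}. $$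
   Context: For $\mathbf{u}=(u_1,\dots,u_N)$, $V_N^{(s/2)}(\mathbf{u})$ is the determinant of the $N\times N$ matrix whose $i$-th row is $(u_i^{-s/2},u_i,u_i^2,\dots,u_i^{N-1})$; in particular $V_N^{(0)}(\mathbf{u})=\prod_{1\le i<j\le N}(u_j-u_i)$. Complex powers of positive reals use the real logarithm. The given density is the Dixon–Anderson density with all exponents equal to $1$ and nodes $u_1,\dots,u_N$. For $N>1$, $$\Gamma_{N-1}\left(\tfrac s2\right)=\frac2s\prod_{n=1}^{N-1}\frac{(1+\frac1n)^{s/2}}{1+\frac{s}{2n}},$$ and the factor $\frac{2}{s\Gamma_{N-1}(s/2)}$ is understood for all $s\in\mathbb{C}$ (in particular at $s=0$) as the entire function $\prod_{n=1}^{N-1}\left(1+\frac{s}{2n}\right)\left(1+\frac1n\right)^{-s/2}$. *)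

theory Defs
  imports "HOL-Probability.Probability" "Jordan_Normal_Form.Determinant"
begin

text \<open>
  Vectors of length \<open>n\<close> are functions on \<open>nat\<close>, of which only the values on \<open>{1..n}\<close> matter.
\<close>

definition vandermonde_prod :: "nat \<Rightarrow> (nat \<Rightarrow> real) \<Rightarrow> real" where
  "vandermonde_prod n x = (\<Prod>j\<in>{1..n}. \<Prod>i\<in>{1..<j}. (x j - x i))"

text \<open>
  Here \<open>p\<close> stands for the superscript \<open>s/2\<close>. Matrix indices start at 0, so row \<open>i\<close> belongs
  to \<open>u (Suc i)\<close>. For positive real base, complex \<open>powr\<close> is the power taken with the real
  logarithm.
\<close>

definition gen_vandermonde :: "nat \<Rightarrow> complex \<Rightarrow> (nat \<Rightarrow> real) \<Rightarrow> complex" where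
  "gen_vandermonde N p u =
     Determinant.det (Matrix.mat N N (\<lambda>(i, j).
       if j = 0 then of_real (u (Suc i)) powr (- p) else of_real (u (Suc i)) ^ j))"

definition interlacing_domain :: "nat \<Rightarrow> (nat \<Rightarrow> real) \<Rightarrow> (nat \<Rightarrow> real) set" where
  "interlacing_domain N u = {x. \<forall>n\<in>{1..N - 1}. u n < x n \<and> x n < u (n + 1)}"

definition dixon_anderson_density :: "nat \<Rightarrow> (nat \<Rightarrow> real) \<Rightarrow> (nat \<Rightarrow> real) \<Rightarrow> real" where
  "dixon_anderson_density N u x =
     fact (N - 1) * (vandermonde_prod (N - 1) x / vandermonde_prod N u)
       * indicator (interlacing_domain N u) x"

text \<open>
  The entire function of \<open>s\<close> which extends \<open>2 / (s * \<Gamma>\<^sub>N\<^sub>-\<^sub>1 (s/2))\<close>. The finite Euler product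
  \<open>\<Gamma>\<^sub>m z\<close> is \<open>Gamma_series_euler' z m\<close>; the lemma below shows the agreement of the two wherever
  the quotient is defined.
\<close>

definition inv_gamma_factor :: "nat \<Rightarrow> complex \<Rightarrow> complex" where
  "inv_gamma_factor N s =
     (\<Prod>n\<in>{1..N - 1}. (1 + s / (2 * of_nat n)) * of_real (1 + 1 / real n) powr (- s / 2))"

lemma inv_gamma_factor_eq:
  assumes "s \<noteq> 0"
  shows "inv_gamma_factor N s = 2 / (s * Gamma_series_euler' (s / 2) (N - 1))"
proof -
  have term_eq: "(1 + s / (2 * of_nat n)) * of_real (1 + 1 / real n) powr (- s / 2)
      = inverse (exp (s / 2 * of_real (ln (1 + inverse (of_nat n)))) / (1 + s / 2 / of_nat n))"
    if "n \<in> {1..N - 1}" for n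
  proof -
    have pos: "1 + 1 / real n > 0"
      by (simp add: add_pos_nonneg)
    have "of_real (1 + 1 / real n) powr (- s / 2)
        = exp ((- s / 2) * complex_of_real (ln (1 + 1 / real n)))"
      unfolding powr_def using pos by (simp add: Ln_of_real del: of_real_add)
    also have "\<dots> = inverse (exp (s / 2 * complex_of_real (ln (1 + inverse (real n)))))"
      by (simp add: exp_minus inverse_eq_divide)
    finally show ?thesis
      by (simp add: inverse_eq_divide mult.commute)
  qed
  have "inv_gamma_factor N s = inverse (\<Prod>n\<in>{1..N - 1}.
      exp (s / 2 * of_real (ln (1 + inverse (of_nat n)))) / (1 + s / 2 / of_nat n))"
    unfolding inv_gamma_factor_def prod_inversef[symmetric] comp_def
    by (rule prod.cong[OF refl term_eq])
  then show ?thesis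
    using assms unfolding Gamma_series_euler'_def by (simp add: field_simps)
qed

end

theory Submission
  imports Defs
begin

text \<open>
  Write \<open>p = s/2\<close> and \<open>m = N - 1\<close>. The product of the Vandermonde product of \<open>x\<close> with
  \<open>\<Prod>i x\<^sub>i powr p\<close> is the determinant of \<open>x\<^sub>i powr (p + j - 1)\<close>, and the interlacing domain is a
  box, so the expectation is a constant multiple of the determinant of the one-dimensional integrals
  \<open>(u\<^sub>i\<^sub>+\<^sub>1 powr (p + j) - u\<^sub>i powr (p + j)) / (p + j)\<close>. The denominators cancel against the gamma
  factor, whose product telescopes to \<open>\<Prod>n\<le>m. (p + n) / n\<close>. The remaining determinant of
  consecutive row differences is the \<open>N \<times> N\<close> determinant with rows
  \<open>(1, u\<^sub>i powr (p + 1), \<dots>, u\<^sub>i powr (p + m))\<close>, that is, the generalised Vandermonde determinant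
  with its rows scaled by \<open>u\<^sub>i powr p\<close>. The second identity is the Laplace expansion of the latter
  along its first column, all of whose minors are Vandermonde determinants.
\<close>

section \<open>Determinant identities\<close>

lemma det_vandermonde:
  fixes v :: "nat \<Rightarrow> 'a::field"
  shows "Determinant.det (Matrix.mat n n (\<lambda>(i, j). v i ^ j)) = (\<Prod>j<n. \<Prod>i<j. v j - v i)"
proof -
  \<comment> \<open>Multiplying by the unitriangular coefficient matrix of the Newton basis \<open>q\<close> replaces
    the monomials by Newton polynomials, which vanish above the diagonal.\<close>
  define q where "q j = (\<Prod>k<j. [:- v k, 1:])" for j
  have deg: "degree (q j) = j" for j
    unfolding q_def by (simp add: degree_prod_eq_sum_degree)
  have monic: "coeff (q j) j = 1" for j
    using lead_coeff_prod[of "\<lambda>k. [:- v k, 1:]" "{..<j}"] by (simp add: deg flip: q_def)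
  define A where "A = Matrix.mat n n (\<lambda>(i, j). v i ^ j)"
  define U where "U = Matrix.mat n n (\<lambda>(l, j). coeff (q j) l)"
  have carr: "A \<in> carrier_mat n n" "U \<in> carrier_mat n n"
    by (simp_all add: A_def U_def)
  have entry: "(A * U) $$ (i, j) = (\<Prod>k<j. v i - v k)" if "i < n" "j < n" for i j
  proof -
    have "(A * U) $$ (i, j) = (\<Sum>l<n. v i ^ l * coeff (q j) l)"
      using that by (simp add: A_def U_def scalar_prod_def lessThan_atLeast0)
    also have "\<dots> = (\<Sum>l\<le>j. v i ^ l * coeff (q j) l)"
      using that by (intro sum.mono_neutral_right) (auto intro!: coeff_eq_0 simp: deg)
    also have "\<dots> = poly (q j) (v i)"
      by (simp add: poly_altdef deg mult.commute)
    also have "\<dots> = (\<Prod>k<j. v i - v k)"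
      by (simp add: q_def poly_prod)
    finally show ?thesis .
  qed
  have "Determinant.det (A * U) = prod_list (diag_mat (A * U))"
    by (rule det_lower_triangular[OF _ mult_carrier_mat[OF carr]])
      (use entry in \<open>auto intro!: prod_zero simp del: index_mult_mat\<close>)
  also have "\<dots> = (\<Prod>j<n. \<Prod>i<j. v j - v i)"
    using carr by (simp add: prod_list_diag_prod entry lessThan_atLeast0 del: index_mult_mat(1))
  finally have 1: "Determinant.det (A * U) = (\<Prod>j<n. \<Prod>i<j. v j - v i)" .
  have "Determinant.det U = prod_list (diag_mat U)"
    by (rule det_upper_triangular[where n = n])
      (use carr in \<open>auto simp: U_def deg upper_triangular_def intro!: coeff_eq_0\<close>)
  also have "\<dots> = 1"
    by (simp add: prod_list_diag_prod U_def monic)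
  finally have "Determinant.det U = 1" .
  with 1 show ?thesis
    using det_mult[OF carr] by (simp add: A_def)
qed

text \<open>Each Leibniz term takes one entry from every row and every column, so both products are
  common to all terms. Later matrices carry an explicit factor 1 wherever only rows or only columns
  are scaled.\<close>

lemma det_scale_rows_cols:
  fixes f :: "nat \<Rightarrow> nat \<Rightarrow> 'a::comm_ring_1"
  shows "Determinant.det (Matrix.mat n n (\<lambda>(i, j). a i * b j * f i j)) =
    (\<Prod>i<n. a i) * (\<Prod>j<n. b j) * Determinant.det (Matrix.mat n n (\<lambda>(i, j). f i j))"
proof -
  have "(\<Prod>i = 0..<n. a i * b (\<sigma> i) * f i (\<sigma> i)) =
      (\<Prod>i<n. a i) * (\<Prod>j<n. b j) * (\<Prod>i = 0..<n. f i (\<sigma> i))"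
    if "\<sigma> permutes {0..<n}" for \<sigma>
    using prod.permute[OF that, of b] by (simp add: prod.distrib lessThan_atLeast0 comp_def)
  then show ?thesis
    by (subst (1 2) det_def'[where n = n])
      (auto simp: sum_distrib_left mult_ac permutes_in_image intro!: sum.cong)
qed

lemma det_first_column_one:
  fixes f :: "nat \<Rightarrow> nat \<Rightarrow> 'a::idom"
  shows "Determinant.det (Matrix.mat (Suc m) (Suc m) (\<lambda>(i, j). if j = 0 then 1 else f i (j - 1))) =
    Determinant.det (Matrix.mat m m (\<lambda>(i, j). f (Suc i) j - f i j))"
    (is "Determinant.det ?B = Determinant.det ?D")
proof -
  \<comment> \<open>\<open>L\<close> forms partial sums of rows, undoing the consecutive differences in \<open>C\<close>.\<close>
  define L :: "'a mat" where "L = Matrix.mat (Suc m) (Suc m) (\<lambda>(i, k). if k \<le> i then 1 else 0)"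
  define R :: "'a mat" where "R = Matrix.mat 1 m (\<lambda>(i, j). f 0 j)"
  \<comment> \<open>The extra row \<open>R\<close> supplies the undifferenced starting values from
    which the partial sums recover \<open>f i j\<close>. Since the column below the corner 1 is
    zero, the border leaves the determinant of the difference matrix unchanged.\<close>
  define C where "C = four_block_mat (1\<^sub>m 1) R (0\<^sub>m m 1) ?D"
  have carr: "L \<in> carrier_mat (Suc m) (Suc m)" "C \<in> carrier_mat (Suc m) (Suc m)"
    by (auto simp: L_def C_def)
  have C_entry: "C $$ (k, j) =
      (if j = 0 then if k = 0 then 1 else 0
       else if k = 0 then f 0 (j - 1) else f k (j - 1) - f (k - 1) (j - 1))"
    if "k < Suc m" "j < Suc m" for k j
    using that by (auto simp: C_def R_def)
  have telescope: "(\<Sum>k\<le>i. if k = 0 then g 0 else g k - g (k - 1)) = g i"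
    for g :: "nat \<Rightarrow> 'a" and i
    by (induction i) auto
  have "L * C = ?B"
  proof (rule eq_matI)
    fix i j assume "i < dim_row ?B" "j < dim_col ?B"
    then have ij: "i < Suc m" "j < Suc m" by auto
    have "(L * C) $$ (i, j) = (\<Sum>k = 0..<Suc m. L $$ (i, k) * C $$ (k, j))"
      using ij carr by (auto simp: scalar_prod_def intro!: sum.cong)
    also have "\<dots> = (\<Sum>k\<le>i. C $$ (k, j))"
      using ij by (intro sum.mono_neutral_cong_right) (auto simp: L_def)
    also have "\<dots> = (\<Sum>k\<le>i. if j = 0 then if k = 0 then 1 else 0
        else if k = 0 then f 0 (j - 1) else f k (j - 1) - f (k - 1) (j - 1))"
      using ij by (intro sum.cong) (simp_all add: C_entry)
    also have "\<dots> = ?B $$ (i, j)"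
      using ij telescope[of "\<lambda>k. f k (j - 1)" i] by (cases "j = 0") auto
    finally show "(L * C) $$ (i, j) = ?B $$ (i, j)" .
  qed (auto simp: L_def C_def)
  moreover have "Determinant.det L = 1"
    by (subst det_lower_triangular[OF _ carr(1)])
      (auto simp: prod_list_diag_prod L_def)
  moreover have "Determinant.det C = Determinant.det ?D"
    unfolding C_def by (subst det_four_block_mat_lower_left_zero) (auto simp: R_def)
  ultimately show ?thesis
    using det_mult[OF carr] by simp
qed

section \<open>Integrating determinants and complex powers\<close>

text \<open>Row \<open>i\<close> involves only the coordinate \<open>x (Suc i)\<close>, so every
  Leibniz term is a product of functions of separate variables and integrates to the product of the
  one-dimensional integrals.\<close>

lemma integral_det_rows:
  fixes g :: "nat \<Rightarrow> nat \<Rightarrow> real \<Rightarrow> complex"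
  assumes int: "\<And>i j. i < m \<Longrightarrow> j < m \<Longrightarrow> integrable lborel (g i j)"
  shows "(\<integral>x. Determinant.det (Matrix.mat m m (\<lambda>(i, j). g i j (x (Suc i)))) \<partial>(\<Pi>\<^sub>M n\<in>{1..m}. lborel)) =
    Determinant.det (Matrix.mat m m (\<lambda>(i, j). integral\<^sup>L lborel (g i j)))"
proof -
  interpret product_sigma_finite "\<lambda>_ :: nat. lborel :: real measure"
    by unfold_locales
  let ?P = "\<Pi>\<^sub>M n\<in>{1..m}. (lborel :: real measure)"
  \<comment> \<open>Coordinates are numbered from 1 and matrix rows from 0:
    \<open>h \<sigma> n\<close> is the factor that depends on coordinate \<open>n\<close>.\<close>
  define h where "h \<sigma> n = g (n - 1) (\<sigma> (n - 1))" for \<sigma> :: "nat \<Rightarrow> nat" and n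
  have det_eq: "Determinant.det (Matrix.mat m m (\<lambda>(i, j). F i j)) =
      (\<Sum>\<sigma> | \<sigma> permutes {0..<m}. signof \<sigma> * (\<Prod>n\<in>{1..m}. F (n - 1) (\<sigma> (n - 1))))"
    for F :: "nat \<Rightarrow> nat \<Rightarrow> complex"
  proof (subst det_def'[where n = m], goal_cases)
    case 2
    have "(\<Prod>i = 0..<m. Matrix.mat m m (\<lambda>(i, j). F i j) $$ (i, \<sigma> i)) =
        (\<Prod>n\<in>{1..m}. F (n - 1) (\<sigma> (n - 1)))" if "\<sigma> permutes {0..<m}" for \<sigma>
      using that by (simp add: prod.atLeast1_atMost_eq lessThan_atLeast0 permutes_in_image)
    then show ?case by (intro sum.cong) auto
  qed simp
  have h_int: "integrable lborel (h \<sigma> n)" if "\<sigma> permutes {0..<m}" "n \<in> {1..m}" for \<sigma> n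
    using permutes_in_image[OF that(1), of "n - 1"] that(2) unfolding h_def
    by (intro int) auto
  have h_eq: "(\<Prod>n\<in>{1..m}. g (n - 1) (\<sigma> (n - 1)) (x (Suc (n - 1)))) = (\<Prod>n\<in>{1..m}. h \<sigma> n (x n))"
    for x \<sigma>
    by (intro prod.cong) (auto simp: h_def)
  have "(\<integral>x. Determinant.det (Matrix.mat m m (\<lambda>(i, j). g i j (x (Suc i)))) \<partial>?P) =
      (\<integral>x. (\<Sum>\<sigma> | \<sigma> permutes {0..<m}. signof \<sigma> * (\<Prod>n\<in>{1..m}. h \<sigma> n (x n))) \<partial>?P)"
    by (subst det_eq) (simp only: h_eq)
  also have "\<dots> = (\<Sum>\<sigma> | \<sigma> permutes {0..<m}. \<integral>x. signof \<sigma> * (\<Prod>n\<in>{1..m}. h \<sigma> n (x n)) \<partial>?P)"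
    by (intro Bochner_Integration.integral_sum integrable_mult_right product_integrable_prod)
      (auto intro: h_int)
  also have "\<dots> = (\<Sum>\<sigma> | \<sigma> permutes {0..<m}. signof \<sigma> * (\<Prod>n\<in>{1..m}. integral\<^sup>L lborel (h \<sigma> n)))"
  proof (intro sum.cong refl)
    fix \<sigma> assume "\<sigma> \<in> {\<sigma>. \<sigma> permutes {0..<m}}"
    then have "(\<integral>x. (\<Prod>n\<in>{1..m}. h \<sigma> n (x n)) \<partial>?P) = (\<Prod>n\<in>{1..m}. integral\<^sup>L lborel (h \<sigma> n))"
      by (intro product_integral_prod) (auto intro: h_int)
    then show "(\<integral>x. signof \<sigma> * (\<Prod>n\<in>{1..m}. h \<sigma> n (x n)) \<partial>?P) =
        signof \<sigma> * (\<Prod>n\<in>{1..m}. integral\<^sup>L lborel (h \<sigma> n))"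
      by simp
  qed
  also have "\<dots> = Determinant.det (Matrix.mat m m (\<lambda>(i, j). integral\<^sup>L lborel (g i j)))"
    by (subst det_eq) (simp add: h_def)
  finally show ?thesis .
qed

text \<open>The branch cut lies on the negative axis, so continuity does not settle the whole line.
  Splitting at 0 leaves real logarithms only, with \<open>\<i> * of_real pi\<close> added for
  negative \<open>x\<close>.\<close>

lemma measurable_of_real_powr [measurable]:
  "(\<lambda>x. complex_of_real x powr p) \<in> borel_measurable borel"
proof -
  have "complex_of_real x powr p = (if x = 0 then 0 else if x > 0 then exp (p * of_real (ln x))
      else exp (p * (of_real (ln (- x)) + \<i> * of_real pi)))" for x
    using Ln_of_real[of "- x"] Ln_minus[of "complex_of_real (- x)"]
    by (auto simp: powr_def Ln_of_real)
  then show ?thesis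
    by (subst measurable_cong) auto
qed

text \<open>The antiderivative is \<open>y powr q / q\<close>; positivity of \<open>a\<close> keeps
  the interval off the branch cut. Open intervals are the sides of the interlacing box.\<close>

lemma has_bochner_integral_powr_Ioo:
  fixes q :: complex
  assumes "0 < a" "a \<le> b" "q \<noteq> 0"
  shows "has_bochner_integral lborel (\<lambda>y. indicator {a<..<b} y *\<^sub>R complex_of_real y powr (q - 1))
    ((of_real b powr q - of_real a powr q) / q)"
proof -
  have "has_bochner_integral lborel (\<lambda>y. indicator {a..b} y *\<^sub>R complex_of_real y powr (q - 1))
      (of_real b powr q / q - of_real a powr q / q)"
  proof (rule has_bochner_integral_FTC_Icc)
    fix y assume y: "a \<le> y" "y \<le> b"
    have "((\<lambda>z. z powr q / q) has_field_derivative of_real y powr (q - 1)) (at (complex_of_real y))"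
      using assms y by (auto intro!: derivative_eq_intros simp: complex_nonpos_Reals_iff)
    then show "((\<lambda>y. complex_of_real y powr q / q) has_vector_derivative of_real y powr (q - 1))
        (at y within {a..b})"
      using has_vector_derivative_real_field has_vector_derivative_at_within by blast
  next
    show "continuous_on {a..b} (\<lambda>y. complex_of_real y powr (q - 1))"
      using assms by (auto intro!: continuous_intros simp: complex_nonpos_Reals_iff)
  qed (use assms in auto)
  \<comment> \<open>The fundamental theorem yields the closed interval, which differs from the open
    one by two null points.\<close>
  moreover have "AE y in lborel. indicator {a..b} y *\<^sub>R complex_of_real y powr (q - 1) =
      indicator {a<..<b} y *\<^sub>R complex_of_real y powr (q - 1)"
    using AE_lborel_singleton[of a] AE_lborel_singleton[of b]
    by eventually_elim (auto simp: indicator_def)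
  moreover have "(\<lambda>y. indicator {a<..<b} y *\<^sub>R complex_of_real y powr (q - 1)) \<in> borel_measurable lborel"
    by measurable
  ultimately show ?thesis
    by (subst has_bochner_integral_cong_AE[symmetric,
          where f = "\<lambda>y. indicator {a..b} y *\<^sub>R complex_of_real y powr (q - 1)"])
      (simp_all add: diff_divide_distrib)
qed

section \<open>Vandermonde products over index sets\<close>

text \<open>An index set instead of a length allows one node to be deleted without renumbering the
  others, as happens in the minors of the Laplace expansion.\<close>

definition vandermonde_set :: "nat set \<Rightarrow> (nat \<Rightarrow> real) \<Rightarrow> real" where
  "vandermonde_set S u = (\<Prod>j\<in>S. \<Prod>i\<in>{i \<in> S. i < j}. (u j - u i))"

lemma vandermonde_prod_eq_set: "vandermonde_prod n u = vandermonde_set {1..n} u"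
  unfolding vandermonde_prod_def vandermonde_set_def
  by (intro prod.cong) auto

text \<open>An increasing renumbering preserves which index of a pair is the larger, so no sign
  changes. This links the consecutive rows of a matrix to index sets with a gap.\<close>

lemma vandermonde_set_strict_mono_image:
  assumes "strict_mono_on A \<phi>"
  shows "vandermonde_set (\<phi> ` A) u = vandermonde_set A (u \<circ> \<phi>)"
proof -
  have inj: "inj_on \<phi> A"
    using assms by (rule strict_mono_on_imp_inj_on)
  have "{i \<in> \<phi> ` A. i < \<phi> j} = \<phi> ` {i \<in> A. i < j}" if "j \<in> A" for j
    using that strict_mono_on_less[OF assms] by auto
  moreover have "inj_on \<phi> {i \<in> A. i < j}" for j
    using inj by (rule inj_on_subset) auto
  ultimately show ?thesis
    unfolding vandermonde_set_def by (simp add: prod.reindex inj)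
qed

lemma vandermonde_set_pos:
  assumes "strict_mono_on S u"
  shows "vandermonde_set S u > 0"
  unfolding vandermonde_set_def
  using assms by (intro prod_pos ballI) (auto dest: strict_mono_onD)

text \<open>For increasing \<open>u\<close> every factor containing \<open>u k\<close> is positive,
  hence an absolute value, whether \<open>k\<close> is the larger or the smaller index of the pair.
  These are the denominators of the final sum.\<close>

lemma vandermonde_set_remove:
  assumes "finite S" "k \<in> S" "strict_mono_on S u"
  shows "vandermonde_set S u = vandermonde_set (S - {k}) u * (\<Prod>j\<in>S - {k}. \<bar>u j - u k\<bar>)"
proof -
  define b where "b j = \<bar>u j - u k\<bar>" for j
  \<comment> \<open>Filling up with 1 puts both kinds of factors over the same set
    \<open>S - {k}\<close>, where they multiply pointwise to \<open>b j\<close>.\<close>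
  have inner_k: "(\<Prod>i\<in>{i \<in> S. i < k}. (u k - u i)) = (\<Prod>j\<in>S - {k}. if j < k then b j else 1)"
  proof -
    have "(\<Prod>i\<in>{i \<in> S. i < k}. (u k - u i)) = (\<Prod>i\<in>{i \<in> S - {k}. i < k}. b i)"
      using assms by (intro prod.cong) (auto simp: b_def abs_if dest: strict_mono_onD)
    then show ?thesis
      using prod.inter_filter[of "S - {k}" b "\<lambda>i. i < k"] assms by simp
  qed
  have inner: "(\<Prod>i\<in>{i \<in> S. i < j}. (u j - u i)) =
      (\<Prod>i\<in>{i \<in> S - {k}. i < j}. (u j - u i)) * (if k < j then b j else 1)"
    if "j \<in> S - {k}" for j
  proof (cases "k < j")
    case True
    then have "{i \<in> S. i < j} = insert k {i \<in> S - {k}. i < j}"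
      using assms by auto
    moreover have "u k < u j"
      using assms that True by (auto dest: strict_mono_onD)
    ultimately show ?thesis
      using assms True by (simp add: b_def)
  next
    case False
    then have "{i \<in> S. i < j} = {i \<in> S - {k}. i < j}" by auto
    with False show ?thesis by simp
  qed
  have "vandermonde_set S u =
      (\<Prod>j\<in>S - {k}. if j < k then b j else 1) * (vandermonde_set (S - {k}) u *
        (\<Prod>j\<in>S - {k}. if k < j then b j else 1))"
    unfolding vandermonde_set_def
    by (subst prod.remove[OF assms(1,2)]) (simp add: inner_k inner prod.distrib)
  also have "\<dots> = vandermonde_set (S - {k}) u *
      (\<Prod>j\<in>S - {k}. (if j < k then b j else 1) * (if k < j then b j else 1))"
    by (simp add: prod.distrib)
  also have "(\<Prod>j\<in>S - {k}. (if j < k then b j else 1) * (if k < j then b j else 1)) =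
      (\<Prod>j\<in>S - {k}. b j)"
    by (intro prod.cong) auto
  finally show ?thesis
    by (simp add: b_def)
qed

section \<open>The generalised Vandermonde determinant\<close>

lemma vandermonde_prod_eq_det:
  "complex_of_real (vandermonde_prod n x) =
    Determinant.det (Matrix.mat n n (\<lambda>(i, j). complex_of_real (x (Suc i)) ^ j))"
proof -
  have "{1..n} = Suc ` {..<n}" "strict_mono_on {..<n} Suc"
    by (auto simp: image_Suc_lessThan strict_mono_on_def)
  then have "vandermonde_prod n x = (\<Prod>j<n. \<Prod>i\<in>{i \<in> {..<n}. i < j}. x (Suc j) - x (Suc i))"
    by (simp only: vandermonde_prod_eq_set vandermonde_set_strict_mono_image)
      (simp add: vandermonde_set_def)
  also have "\<dots> = (\<Prod>j<n. \<Prod>i<j. x (Suc j) - x (Suc i))"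
    by (intro prod.cong) auto
  finally show ?thesis
    by (simp add: det_vandermonde)
qed

lemma gen_vandermonde_zero:
  assumes "\<And>n. n \<in> {1..N} \<Longrightarrow> u n > 0"
  shows "gen_vandermonde N 0 u = of_real (vandermonde_prod N u)"
proof -
  \<comment> \<open>The first column is constantly 1 only for nonzero nodes, because
    \<open>0 powr 0\<close> is 0.\<close>
  have "u (Suc i) \<noteq> 0" if "i < N" for i
    using assms[of "Suc i"] that by simp
  then show ?thesis
    unfolding gen_vandermonde_def vandermonde_prod_eq_det
    by (intro arg_cong[where f = Determinant.det] eq_matI) auto
qed

text \<open>Deleting the first column leaves rows of the form \<open>u j\<close> times
  \<open>1, u j, u j ^ 2, ...\<close>. Pulling \<open>u j\<close> out of each row turns every minor
  into an ordinary Vandermonde determinant of the remaining nodes.\<close>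

lemma gen_vandermonde_expand:
  assumes "N \<ge> 1"
  shows "gen_vandermonde N p u = (\<Sum>n\<in>{1..N}. (- 1) ^ (n - 1) * of_real (u n) powr (- p) *
    of_real ((\<Prod>j\<in>{1..N} - {n}. u j) * vandermonde_set ({1..N} - {n}) u))"
proof -
  define A where "A = Matrix.mat N N (\<lambda>(i, j).
       if j = 0 then of_real (u (Suc i)) powr (- p) else complex_of_real (u (Suc i)) ^ j)"
  define m where "m = N - 1"
  have minor: "Determinant.det (mat_delete A k 0) =
      of_real ((\<Prod>j\<in>{1..N} - {Suc k}. u j) * vandermonde_set ({1..N} - {Suc k}) u)"
    if k: "k < N" for k
  proof -
    \<comment> \<open>\<open>\<phi>\<close> sends a row of the minor to its node: it jumps over the
      deleted row \<open>k\<close> and shifts from numbering at 0 to numbering at 1.\<close>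
    define \<phi> where "\<phi> i = Suc (if i < k then i else Suc i)" for i
    have N: "N = Suc m"
      using k by (simp add: m_def)
    have mono: "strict_mono_on {..<m} \<phi>"
      by (auto simp: strict_mono_on_def \<phi>_def)
    have img: "\<phi> ` {..<m} = {1..N} - {Suc k}"
    proof (intro equalityI subsetI)
      fix n assume "n \<in> {1..N} - {Suc k}"
      \<comment> \<open>Nodes before the gap come from row \<open>n - 1\<close>, those after it from
        row \<open>n - 2\<close>.\<close>
      then have "n = \<phi> (if n \<le> k then n - 1 else n - 2)" "(if n \<le> k then n - 1 else n - 2) < m"
        using k N by (auto simp: \<phi>_def split: if_splits)
      then show "n \<in> \<phi> ` {..<m}" by blast
    qed (use k N in \<open>auto simp: \<phi>_def split: if_splits\<close>)
    have "mat_delete A k 0 =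
        Matrix.mat m m (\<lambda>(i, j). complex_of_real (u (\<phi> i)) * 1 * complex_of_real (u (\<phi> i)) ^ j)"
      using k by (intro eq_matI) (auto simp: mat_delete_def A_def N \<phi>_def)
    then have "Determinant.det (mat_delete A k 0) = of_real ((\<Prod>i<m. u (\<phi> i)) *
        (\<Prod>j<m. \<Prod>i<j. u (\<phi> j) - u (\<phi> i)))"
      by (simp only: det_scale_rows_cols det_vandermonde) simp
    also have "(\<Prod>j<m. \<Prod>i<j. u (\<phi> j) - u (\<phi> i)) = vandermonde_set {..<m} (u \<circ> \<phi>)"
      unfolding vandermonde_set_def by (intro prod.cong) auto
    also have "\<dots> = vandermonde_set ({1..N} - {Suc k}) u"
      using vandermonde_set_strict_mono_image[OF mono] img by simp
    also have "(\<Prod>i<m. u (\<phi> i)) = (\<Prod>j\<in>{1..N} - {Suc k}. u j)"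
      using prod.reindex[OF strict_mono_on_imp_inj_on[OF mono], of u] img by simp
    finally show ?thesis .
  qed
  have "gen_vandermonde N p u = (\<Sum>k<N. A $$ (k, 0) * cofactor A k 0)"
    unfolding gen_vandermonde_def A_def[symmetric]
    by (rule laplace_expansion_column) (use assms in \<open>auto simp: A_def\<close>)
  also have "\<dots> = (\<Sum>k<N. (- 1) ^ k * of_real (u (Suc k)) powr (- p) *
      of_real ((\<Prod>j\<in>{1..N} - {Suc k}. u j) * vandermonde_set ({1..N} - {Suc k}) u))"
    using assms by (intro sum.cong refl) (simp add: cofactor_def minor, simp add: A_def)
  finally show ?thesis
    by (simp add: sum.atLeast1_atMost_eq)
qed

section \<open>The gamma factor\<close>

text \<open>Since \<open>1 + 1 / n = (n + 1) / n\<close>, the powers telescope and cancel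
  \<open>of_nat N powr (s / 2)\<close>. What remains is the product of
  \<open>1 + s / (2 * n) = (s / 2 + n) / n\<close>.\<close>

lemma inv_gamma_factor_mult_powr:
  assumes "N \<ge> 1"
  shows "inv_gamma_factor N s * of_nat N powr (s / 2) =
    (\<Prod>n\<in>{1..N - 1}. s / 2 + of_nat n) / fact (N - 1)"
proof -
  have "inv_gamma_factor (Suc m) s * of_nat (Suc m) powr (s / 2) =
      (\<Prod>n\<in>{1..m}. s / 2 + of_nat n) / fact m" for m
  proof (induction m)
    case 0
    then show ?case by (simp add: inv_gamma_factor_def)
  next
    case (Suc m)
    have powr_eq: "complex_of_real r powr a = exp (a * of_real (ln r))" if "r > 0" for r a
      using that by (simp add: powr_def Ln_of_real)
    have quot: "complex_of_real (b / a) powr (- q) * of_real b powr q = of_real a powr q"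
      if "a > 0" "b > 0" for a b q
      using that by (simp add: powr_eq ln_div algebra_simps del: of_real_divide flip: exp_add)
    have "1 + 1 / real (Suc m) = real (Suc (Suc m)) / real (Suc m)"
      by (simp add: field_simps)
    then have "complex_of_real (1 + 1 / real (Suc m)) powr (- (s / 2)) *
        of_real (real (Suc (Suc m))) powr (s / 2) = of_real (real (Suc m)) powr (s / 2)"
      by (simp only: quot of_nat_0_less_iff zero_less_Suc)
    then have "complex_of_real (1 + 1 / real (Suc m)) powr (- s / 2) * of_nat (Suc (Suc m)) powr (s / 2)
        = of_nat (Suc m) powr (s / 2)"
      by (simp only: of_real_of_nat_eq minus_divide_left)
    then have "inv_gamma_factor (Suc (Suc m)) s * of_nat (Suc (Suc m)) powr (s / 2) =
        inv_gamma_factor (Suc m) s * of_nat (Suc m) powr (s / 2) * (1 + s / (2 * of_nat (Suc m)))"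
      by (simp add: inv_gamma_factor_def mult_ac del: of_nat_Suc of_real_add)
    also have "\<dots> = (\<Prod>n\<in>{1..m}. s / 2 + of_nat n) / fact m * (1 + s / (2 * of_nat (Suc m)))"
      by (simp only: Suc)
    also have "\<dots> = (\<Prod>n\<in>{1..Suc m}. s / 2 + of_nat n) / fact (Suc m)"
      by (simp add: field_simps del: of_nat_Suc)
    finally show ?case .
  qed
  from this[of "N - 1"] show ?thesis
    using assms by simp
qed

section \<open>The Dixon-Anderson integral\<close>

text \<open>The denominator depends on the column only, so the outer product clears it. Bordering
  the row differences by a column of ones and extracting \<open>u powr p\<close> from each row then
  turns the ones into \<open>u powr (- p)\<close> and the other entries into integer powers.\<close>

lemma det_powr_integrals:
  assumes pos: "\<And>n. n \<in> {1..Suc m} \<Longrightarrow> u n > 0"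
    and p: "\<And>n. n \<in> {1..m} \<Longrightarrow> p + of_nat n \<noteq> 0"
  shows "(\<Prod>n\<in>{1..m}. p + of_nat n) * Determinant.det (Matrix.mat m m (\<lambda>(i, j).
      (of_real (u (i + 2)) powr (p + of_nat (Suc j)) - of_real (u (Suc i)) powr (p + of_nat (Suc j)))
        / (p + of_nat (Suc j)))) =
    (\<Prod>n\<in>{1..Suc m}. of_real (u n) powr p) * gen_vandermonde (Suc m) p u"
proof -
  define f where "f i j = complex_of_real (u (Suc i)) powr (p + of_nat (Suc j))" for i j
  define b where "b j = p + of_nat (Suc j)" for j
  have b0: "b j \<noteq> 0" if "j < m" for j
    using p[of "Suc j"] that by (simp add: b_def)
  have b_inv: "(\<Prod>j<m. b j) * (\<Prod>j<m. inverse (b j)) = 1"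
    using b0 by (simp flip: prod.distrib)
  have f_eq: "f i j = of_real (u (Suc i)) powr p * of_real (u (Suc i)) ^ Suc j" if "i \<le> m" for i j
    using pos[of "Suc i"] that unfolding f_def powr_add powr_nat by auto
  have one: "complex_of_real (u (Suc i)) powr p * of_real (u (Suc i)) powr (- p) = 1" if "i \<le> m" for i
    using pos[of "Suc i"] that by (simp flip: powr_add)
  have "Determinant.det (Matrix.mat m m (\<lambda>(i, j). (f (Suc i) j - f i j) / b j)) =
      Determinant.det (Matrix.mat m m (\<lambda>(i, j). 1 * inverse (b j) * (f (Suc i) j - f i j)))"
    by (simp add: field_simps)
  also have "\<dots> = (\<Prod>j<m. inverse (b j)) *
      Determinant.det (Matrix.mat m m (\<lambda>(i, j). f (Suc i) j - f i j))"
    by (simp only: det_scale_rows_cols) simp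
  also have "Determinant.det (Matrix.mat m m (\<lambda>(i, j). f (Suc i) j - f i j)) =
      Determinant.det (Matrix.mat (Suc m) (Suc m) (\<lambda>(i, j). if j = 0 then 1 else f i (j - 1)))"
    by (simp only: det_first_column_one)
  also have "Matrix.mat (Suc m) (Suc m) (\<lambda>(i, j). if j = 0 then 1 else f i (j - 1)) =
      Matrix.mat (Suc m) (Suc m) (\<lambda>(i, j). of_real (u (Suc i)) powr p * 1 *
       (if j = 0 then of_real (u (Suc i)) powr (- p) else of_real (u (Suc i)) ^ j))"
    by (intro eq_matI) (auto simp: f_eq one)
  also have "Determinant.det \<dots> = (\<Prod>i<Suc m. of_real (u (Suc i)) powr p) * gen_vandermonde (Suc m) p u"
    unfolding gen_vandermonde_def by (simp only: det_scale_rows_cols) simp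
  finally have "(\<Prod>j<m. b j) * Determinant.det (Matrix.mat m m (\<lambda>(i, j). (f (Suc i) j - f i j) / b j)) =
      (\<Prod>i<Suc m. of_real (u (Suc i)) powr p) * gen_vandermonde (Suc m) p u"
    using b_inv by (simp add: mult.assoc[symmetric])
  then show ?thesis
    unfolding b_def f_def One_nat_def prod.atLeast1_atMost_eq by simp
qed

text \<open>Interlacing gives \<open>x i < u (i + 1) <= u j < x j\<close> for \<open>i < j\<close>,
  so both Vandermonde products are positive on the domain. Nonnegativity is what allows the
  \<open>ennreal\<close> around the density to be undone.\<close>

lemma dixon_anderson_density_nonneg:
  assumes "strict_mono_on {1..N} u"
  shows "dixon_anderson_density N u x \<ge> 0"
proof (cases "x \<in> interlacing_domain N u")
  case True
  have "strict_mono_on {1..N - 1} x"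
  proof (rule strict_mono_onI)
    fix i j assume ij: "i \<in> {1..N - 1}" "j \<in> {1..N - 1}" "i < j"
    then have "x i < u (i + 1)" "u j < x j"
      using True by (auto simp: interlacing_domain_def)
    moreover have "u (i + 1) \<le> u j"
      using ij by (intro strict_mono_on_leD[OF assms]) auto
    ultimately show "x i < x j" by linarith
  qed
  then show ?thesis
    using vandermonde_set_pos[OF assms] vandermonde_set_pos[of "{1..N - 1}" x]
    by (simp add: dixon_anderson_density_def vandermonde_prod_eq_set)
qed (simp add: dixon_anderson_density_def)

text \<open>The indicator of the box and the product of powers both factor over the coordinates, so
  they can be absorbed into the rows of the Vandermonde determinant of \<open>x\<close>, which is
  then integrated row by row.\<close>

lemma integral_dixon_anderson_density:
  assumes pos: "\<And>n. n \<in> {1..Suc m} \<Longrightarrow> u n > 0"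
    and mono: "strict_mono_on {1..Suc m} u"
    and p: "\<And>n. n \<in> {1..m} \<Longrightarrow> p + of_nat n \<noteq> 0"
  shows "(\<Prod>n\<in>{1..m}. p + of_nat n) * (\<integral>x. dixon_anderson_density (Suc m) u x *\<^sub>R
      (\<Prod>n\<in>{1..m}. complex_of_real (x n) powr p) \<partial>(\<Pi>\<^sub>M n\<in>{1..m}. lborel)) =
    fact m * (\<Prod>n\<in>{1..Suc m}. of_real (u n) powr p) * gen_vandermonde (Suc m) p u
      / gen_vandermonde (Suc m) 0 u"
proof -
  \<comment> \<open>The exponent is \<open>p + j\<close>, written as \<open>q - 1\<close> with
    \<open>q = p + of_nat (Suc j)\<close>, the nonzero exponent of the antiderivative.\<close>
  define g where "g i j y = indicator {u (Suc i)<..<u (i + 2)} y *\<^sub>R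
      complex_of_real y powr (p + of_nat (Suc j) - 1)" for i j y
  define c where "c = complex_of_real (fact m / vandermonde_prod (Suc m) u)"
  have less: "u (Suc i) < u (i + 2)" "u (Suc i) > 0" if "i < m" for i
    using that pos by (auto intro: strict_mono_onD[OF mono])
  have g_int: "has_bochner_integral lborel (g i j)
      ((of_real (u (i + 2)) powr (p + of_nat (Suc j)) - of_real (u (Suc i)) powr (p + of_nat (Suc j)))
        / (p + of_nat (Suc j)))" if "i < m" "j < m" for i j
    using that p[of "Suc j"] less[of i] unfolding g_def
    by (intro has_bochner_integral_powr_Ioo) auto
  have "dixon_anderson_density (Suc m) u x *\<^sub>R (\<Prod>n\<in>{1..m}. complex_of_real (x n) powr p) =
      c * Determinant.det (Matrix.mat m m (\<lambda>(i, j). g i j (x (Suc i))))" for x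
  proof -
    define I where "I i = (indicator {u (Suc i)<..<u (i + 2)} (x (Suc i)) :: complex)" for i
    have "interlacing_domain (Suc m) u = {x. \<forall>i<m. x (Suc i) \<in> {u (Suc i)<..<u (i + 2)}}"
      using image_Suc_lessThan[of m, symmetric]
      by (auto simp: interlacing_domain_def simp del: atLeastAtMost_iff)
    then have ind: "complex_of_real (indicator (interlacing_domain (Suc m) u) x) = (\<Prod>i<m. I i)"
      by (cases "x \<in> interlacing_domain (Suc m) u") (auto simp: I_def indicator_def)
    have g_eq: "g i j (x (Suc i)) = I i * complex_of_real (x (Suc i)) powr p * 1 *
        complex_of_real (x (Suc i)) ^ j" if "i < m" for i j
    \<comment> \<open>The power splits for positive arguments; elsewhere both sides vanish, because
      the interval starts at a positive node.\<close>
    proof (cases "x (Suc i) > 0")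
      case True
      then show ?thesis
        by (simp add: g_def I_def powr_add powr_nat indicator_def)
    next
      case False
      then show ?thesis
        using less[OF that] by (simp add: g_def I_def)
    qed
    have "Matrix.mat m m (\<lambda>(i, j). g i j (x (Suc i))) = Matrix.mat m m
        (\<lambda>(i, j). (I i * complex_of_real (x (Suc i)) powr p) * 1 * complex_of_real (x (Suc i)) ^ j)"
      by (intro eq_matI) (auto simp: g_eq)
    then have "Determinant.det (Matrix.mat m m (\<lambda>(i, j). g i j (x (Suc i)))) =
        (\<Prod>i<m. I i) * (\<Prod>i<m. complex_of_real (x (Suc i)) powr p) * of_real (vandermonde_prod m x)"
      by (simp only: det_scale_rows_cols vandermonde_prod_eq_det prod.distrib) simp
    then show ?thesis
      unfolding dixon_anderson_density_def One_nat_def prod.atLeast1_atMost_eq ind[symmetric]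
      by (simp add: c_def scaleR_conv_of_real mult_ac)
  qed
  then have "(\<integral>x. dixon_anderson_density (Suc m) u x *\<^sub>R
      (\<Prod>n\<in>{1..m}. complex_of_real (x n) powr p) \<partial>(\<Pi>\<^sub>M n\<in>{1..m}. lborel)) =
      c * (\<integral>x. Determinant.det (Matrix.mat m m (\<lambda>(i, j). g i j (x (Suc i)))) \<partial>(\<Pi>\<^sub>M n\<in>{1..m}. lborel))"
    by (simp only: integral_mult_right_zero)
  also have "\<dots> = c * Determinant.det (Matrix.mat m m (\<lambda>(i, j). integral\<^sup>L lborel (g i j)))"
    by (subst integral_det_rows) (use g_int in \<open>auto simp: has_bochner_integral_iff\<close>)
  also have "Matrix.mat m m (\<lambda>(i, j). integral\<^sup>L lborel (g i j)) = Matrix.mat m m (\<lambda>(i, j).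
      (of_real (u (i + 2)) powr (p + of_nat (Suc j)) - of_real (u (Suc i)) powr (p + of_nat (Suc j)))
        / (p + of_nat (Suc j)))"
    by (intro eq_matI) (use g_int in \<open>auto simp: has_bochner_integral_iff\<close>)
  finally have "(\<Prod>n\<in>{1..m}. p + of_nat n) * (\<integral>x. dixon_anderson_density (Suc m) u x *\<^sub>R
      (\<Prod>n\<in>{1..m}. complex_of_real (x n) powr p) \<partial>(\<Pi>\<^sub>M n\<in>{1..m}. lborel)) =
      c * ((\<Prod>n\<in>{1..Suc m}. of_real (u n) powr p) * gen_vandermonde (Suc m) p u)"
    by (simp only: mult.left_commute[of _ c] det_powr_integrals[where m = m and u = u and p = p, OF pos p])
  moreover have "gen_vandermonde (Suc m) 0 u = of_real (vandermonde_prod (Suc m) u)"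
    using pos by (rule gen_vandermonde_zero)
  ultimately show ?thesis
    by (simp add: c_def)
qed

section \<open>The expectation formula and the explicit sum\<close>

theorem proposition5:
  fixes N :: nat and u :: "nat \<Rightarrow> real" and s :: complex
    and M :: "'a measure" and X :: "'a \<Rightarrow> nat \<Rightarrow> real"
  assumes N: "N \<ge> 2"
    and u_pos: "0 < u 1"
    and u_mono: "strict_mono_on {1..N} u"
    and s: "\<And>k. k \<in> {1..N - 1} \<Longrightarrow> s \<noteq> - 2 * of_nat k"
    and M: "prob_space M"
    and X: "distributed M (\<Pi>\<^sub>M n\<in>{1..N - 1}. lborel) X
              (\<lambda>x. ennreal (dixon_anderson_density N u x))"
  shows "inv_gamma_factor N s * of_nat N powr (s / 2)
           * prob_space.expectation M (\<lambda>\<omega>.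
               (\<Prod>n\<in>{1..N - 1}. complex_of_real (X \<omega> n) powr (s / 2))
                 / (\<Prod>n\<in>{1..N}. complex_of_real (u n) powr (s / 2)))
         = gen_vandermonde N (s / 2) u / gen_vandermonde N 0 u
       \<and> gen_vandermonde N (s / 2) u / gen_vandermonde N 0 u
         = (\<Sum>n\<in>{1..N}. (- 1) ^ (n - 1) * (1 / complex_of_real (u n) powr (s / 2))
              * of_real (\<Prod>j\<in>{1..N} - {n}. u j / \<bar>u j - u n\<bar>))"
proof
  define m where "m = N - 1"
  define p where "p = s / 2"
  have N_eq: "N = Suc m"
    using N by (simp add: m_def)
  have pos: "u n > 0" if "n \<in> {1..N}" for n
  proof -
    have "u 1 \<le> u n"
      using that N by (intro strict_mono_on_leD[OF u_mono]) auto
    with u_pos show ?thesis by linarith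
  qed
  \<comment> \<open>The excluded values of \<open>s\<close> are exactly the zeros of these
    denominators.\<close>
  have p: "p + of_nat n \<noteq> 0" if "n \<in> {1..m}" for n
  proof
    assume "p + of_nat n = 0"
    then have "s = - 2 * of_nat n"
      by (simp add: p_def add_eq_0_iff field_simps)
    with s[of n] that show False
      by (simp add: m_def)
  qed
  let ?P = "\<Pi>\<^sub>M n\<in>{1..m}. (lborel :: real measure)"
  let ?d = "dixon_anderson_density N u"
  let ?U = "\<Prod>n\<in>{1..N}. complex_of_real (u n) powr p"
  let ?F = "\<lambda>x. (\<Prod>n\<in>{1..m}. complex_of_real (x n) powr p) / ?U"
  have X': "distributed M ?P X (\<lambda>x. ennreal (?d x))"
    using X by (simp add: m_def)
  have d_nonneg: "?d x \<ge> 0" for x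
    using u_mono by (rule dixon_anderson_density_nonneg)
  have [measurable]: "X \<in> measurable M ?P"
    using distributed_measurable[OF X'] .
  \<comment> \<open>\<open>distributed\<close> provides measurability only for the
    \<open>ennreal\<close> version; \<open>enn2real\<close> brings it back to the real
    density.\<close>
  have d_meas: "?d \<in> borel_measurable ?P"
  proof -
    have "(\<lambda>x. ennreal (?d x)) \<in> borel_measurable ?P"
      using distributed_borel_measurable[OF X'] .
    then have "(\<lambda>x. enn2real (ennreal (?d x))) \<in> borel_measurable ?P"
      by measurable
    then show ?thesis
      unfolding enn2real_ennreal[OF d_nonneg] .
  qed
  have F_meas [measurable]: "?F \<in> borel_measurable ?P"
    by measurable
  have U_nz: "?U \<noteq> 0"
    using pos by force
  have "prob_space.expectation M (\<lambda>\<omega>. ?F (X \<omega>)) = integral\<^sup>L (distr M ?P X) ?F"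
    by (rule integral_distr[symmetric]) measurable
  also have "distr M ?P X = density ?P (\<lambda>x. ennreal (?d x))"
    using distributed_distr_eq_density[OF X'] .
  also have "integral\<^sup>L \<dots> ?F = (\<integral>x. ?d x *\<^sub>R ?F x \<partial>?P)"
    by (rule integral_density[OF F_meas d_meas]) (simp add: d_nonneg)
  also have "\<dots> = (\<integral>x. ?d x *\<^sub>R (\<Prod>n\<in>{1..m}. complex_of_real (x n) powr p) \<partial>?P) / ?U"
    by (simp only: integral_divide_zero[symmetric] scaleR_conv_of_real times_divide_eq_right)
  finally have E: "prob_space.expectation M (\<lambda>\<omega>. ?F (X \<omega>)) =
      (\<integral>x. ?d x *\<^sub>R (\<Prod>n\<in>{1..m}. complex_of_real (x n) powr p) \<partial>?P) / ?U" .
  have "inv_gamma_factor N s * of_nat N powr p * prob_space.expectation M (\<lambda>\<omega>. ?F (X \<omega>)) =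
      ((\<Prod>n\<in>{1..m}. p + of_nat n) *
        (\<integral>x. ?d x *\<^sub>R (\<Prod>n\<in>{1..m}. complex_of_real (x n) powr p) \<partial>?P)) / (fact m * ?U)"
    using inv_gamma_factor_mult_powr[of N s] N unfolding E by (simp add: p_def m_def)
  also have "(\<Prod>n\<in>{1..m}. p + of_nat n) *
        (\<integral>x. ?d x *\<^sub>R (\<Prod>n\<in>{1..m}. complex_of_real (x n) powr p) \<partial>?P) =
      fact m * ?U * gen_vandermonde N p u / gen_vandermonde N 0 u"
    using integral_dixon_anderson_density[of m u p] pos u_mono p unfolding N_eq by blast
  also have "\<dots> / (fact m * ?U) = gen_vandermonde N p u / gen_vandermonde N 0 u"
    using U_nz by simp
  finally show "inv_gamma_factor N s * of_nat N powr (s / 2)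
      * prob_space.expectation M (\<lambda>\<omega>.
          (\<Prod>n\<in>{1..N - 1}. complex_of_real (X \<omega> n) powr (s / 2))
            / (\<Prod>n\<in>{1..N}. complex_of_real (u n) powr (s / 2)))
    = gen_vandermonde N (s / 2) u / gen_vandermonde N 0 u"
    by (simp only: p_def m_def)

  \<comment> \<open>Splitting the full Vandermonde product at node \<open>n\<close> cancels the
    minor, so only the factors involving \<open>u n\<close> stay in the denominator.\<close>
  have "of_real ((\<Prod>j\<in>{1..N} - {n}. u j) * vandermonde_set ({1..N} - {n}) u) / gen_vandermonde N 0 u =
      complex_of_real (\<Prod>j\<in>{1..N} - {n}. u j / \<bar>u j - u n\<bar>)" if n: "n \<in> {1..N}" for n
  proof -
    have "vandermonde_set ({1..N} - {n}) u > 0"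
      using u_mono by (intro vandermonde_set_pos) (auto simp: strict_mono_on_def)
    moreover have "vandermonde_prod N u =
        vandermonde_set ({1..N} - {n}) u * (\<Prod>j\<in>{1..N} - {n}. \<bar>u j - u n\<bar>)"
      unfolding vandermonde_prod_eq_set by (intro vandermonde_set_remove n u_mono) simp
    moreover have "gen_vandermonde N 0 u = of_real (vandermonde_prod N u)"
      using pos by (rule gen_vandermonde_zero)
    ultimately show ?thesis
      by (simp add: prod_dividef flip: of_real_divide of_real_mult)
  qed
  moreover have "N \<ge> 1"
    using N by simp
  ultimately show "gen_vandermonde N (s / 2) u / gen_vandermonde N 0 u
      = (\<Sum>n\<in>{1..N}. (- 1) ^ (n - 1) * (1 / complex_of_real (u n) powr (s / 2))
           * of_real (\<Prod>j\<in>{1..N} - {n}. u j / \<bar>u j - u n\<bar>))"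
    unfolding gen_vandermonde_expand[of N "s / 2" u, OF \<open>N \<ge> 1\<close>] sum_divide_distrib
    by (intro sum.cong refl) (simp add: powr_minus inverse_eq_divide flip: times_divide_eq_right)
qed

end
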